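(* Let $(q^3;q)_\infty=\prod_{j\geq 3}(1-q^j)=\sum_{i\geq 0}b_iq^i$ be the power series expansion. For every integer $i\geq 0$ there exists a unique integer $n\geq 0$ such that $p_1(2n)-2\leq i\leq p_1(2n+2)-3$, and for this $n$ $$b_i=\begin{cases} -n,&\text{if } p_1(2n)-2\leq i\leq p_2(2n)-1,\\ 1-n+\left\lfloor\frac{i-p_2(2n)}{2}\right\rfloor,&\text{if } p_2(2n)\leq i\leq p_1(2n+1)-2,\\ 1+n,&\text{if } p_1(2n+1)-1\leq i\leq p_2(2n+1)-2\text{ and } i\equiv p_2(2n)\pmod 2,\\ n,&\text{if } p_1(2n+1)-1\leq i\leq p_2(2n+1)-2\text{ and } i\not\equiv p_2(2n)\pmod 2,\\ n-\left\lceil\frac{i-p_2(2n+1)}{2}\right\rceil,&\text{if } p_2(2n+1)-1\leq i\leq p_1(2n+2)-3. \end{cases}$$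
   Context: For integers $n\geq 0$, $p_1(n)=\frac{n(3n-1)}{2}$ and $p_2(n)=\frac{n(3n+1)}{2}$ (the two families of pentagonal numbers). $\lfloor x\rfloor$ is the greatest integer $\leq x$ and $\lceil x\rceil$ is the smallest integer $\geq x$. The product $(q^3;q)_\infty=\prod_{j\geq 3}(1-q^j)$ is regarded as a power series in $q$ (convergent for $|q|<1$). *)

theory Defs
  imports "HOL-Analysis.Analysis" "HOL-Computational_Algebra.Formal_Power_Series"
    "HOL-Number_Theory.Cong"
begin

text \<open>The divisions are exact.\<close>

definition p1 :: "nat \<Rightarrow> int" where
  "p1 n = int n * (3 * int n - 1) div 2"

definition p2 :: "nat \<Rightarrow> int" where
  "p2 n = int n * (3 * int n + 1) div 2"

text \<open>The infinite \<open>q\<close>-Pochhammer symbol \<open>(a; q)\<^sub>\<infinity>\<close>.  On formal power series the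
  limit is taken in the \<open>X\<close>-adic metric, i.e. every coefficient is eventually constant.\<close>

definition qpochhammer_inf :: "'a \<Rightarrow> 'a \<Rightarrow> 'a :: {t2_space, comm_ring_1}" where
  "qpochhammer_inf a q = (\<Prod>k. 1 - a * q ^ k)"

text \<open>\<^const>\<open>prodinf\<close> is unspecified for divergent products; the following shows that the
  product in question does converge.\<close>

lemma has_prod_qpochhammer_inf_X3:
  "(\<lambda>k. 1 - fps_X ^ 3 * fps_X ^ k :: int fps) has_prod qpochhammer_inf (fps_X ^ 3) fps_X"
proof -
  define f where "f = (\<lambda>k. 1 - fps_X ^ 3 * fps_X ^ k :: int fps)"
  define P where "P = (\<lambda>n. \<Prod>k\<le>n. f k)"
  define L where "L = Abs_fps (\<lambda>i. fps_nth (P i) i)"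
  have Suc_eq: "fps_nth (P (Suc n)) i = fps_nth (P n) i" if "i \<le> n" for n i
  proof -
    have "P (Suc n) = P n * (1 - fps_X ^ (3 + Suc n))"
      unfolding P_def f_def power_add by simp
    also have "\<dots> = P n - P n * fps_X ^ (3 + Suc n)"
      by (simp only: right_diff_distrib mult_1_right)
    finally have "P (Suc n) = P n - P n * fps_X ^ (3 + Suc n)" .
    then show ?thesis
      using that by (simp add: fps_X_power_mult_right_nth)
  qed
  have stable: "fps_nth (P n) i = fps_nth (P i) i" if "i \<le> n" for n i
    using that by (induction n rule: dec_induct) (simp_all add: Suc_eq)
  have lim: "P \<longlonglongrightarrow> L"
  proof (rule tendsto_fpsI)
    fix i
    show "\<forall>\<^sub>F n in sequentially. fps_nth (P n) i = fps_nth L i"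
      using eventually_ge_at_top[of i] by eventually_elim (metis L_def fps_nth_Abs_fps stable)
  qed
  have "fps_nth L 0 = 1"
    by (simp add: L_def P_def f_def)
  then have "L \<noteq> 0"
    by auto
  with lim have "f has_prod L"
    by (simp add: has_prod_def raw_has_prod_def P_def)
  then show ?thesis
    using has_prod_unique[of f L] by (simp add: f_def qpochhammer_inf_def)
qed

end

theory Submission
  imports Defs "HOL-Library.Nat_Bijection"
begin

text \<open>
  Writing $E = \prod_{j \ge 1} (1 - q^j)$, we have
  $(q^3; q)_\infty = E \cdot \frac{1}{(1 - q)(1 - q^2)}$, and the second factor has coefficients
  $\lfloor m / 2 \rfloor + 1$.  Euler's pentagonal number theorem (in the finite form due to Shanks)
  turns $b_i$ into an alternating sum of the numbers $\lfloor (i - p) / 2 \rfloor + 1$ over the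
  pentagonal numbers $p \le i$.  Over four consecutive pentagonal numbers
  $p_1(2n+1), p_2(2n+1), p_1(2n+2), p_2(2n+2)$ this sum telescopes, as their distances from
  $p_2(2n)$ are linear in $n$.
\<close>

section \<open>Shanks's finite form of the pentagonal number theorem\<close>

text \<open>The product over \<open>{s<..n}\<close> is the quotient (q;q)_n / (q;q)_s, written
  without division so that any commutative ring is allowed.\<close>

definition shanks_sum :: "'a::comm_ring_1 \<Rightarrow> nat \<Rightarrow> 'a" where
  "shanks_sum q n = (\<Sum>s\<le>n. (-1) ^ s * q ^ (s * n + triangle s) * (\<Prod>j\<in>{s<..n}. 1 - q ^ j))"

text \<open>The differences between the summands for \<open>Suc n\<close> and for \<open>n\<close>
  telescope over \<open>s\<close>. Only the end of the telescope and the new summand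
  \<open>s = Suc n\<close> survive; their exponents are \<open>p1 (Suc n)\<close> and
  \<open>p2 (Suc n)\<close>.\<close>

lemma shanks_sum_Suc:
  fixes q :: "'a::comm_ring_1"
  shows "shanks_sum q (Suc n) = shanks_sum q n +
    (-1) ^ Suc n * (q ^ (Suc n * Suc n + triangle n) + q ^ (Suc n * Suc n + triangle (Suc n)))"
proof -
  define D where "D s = (\<Prod>j\<in>{s<..n}. 1 - q ^ j)" for s
  define t where "t s = (-1) ^ s * q ^ (s * n + triangle s) * D s" for s
  define t' where
    "t' s = (-1) ^ s * q ^ (s * Suc n + triangle s) * (\<Prod>j\<in>{s<..Suc n}. 1 - q ^ j)" for s
  have t'_eq: "t' s = t s * (q ^ s * (1 - q ^ Suc n))" if "s \<le> n" for s
  proof -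
    have "{s<..Suc n} = insert (Suc n) {s<..n}"
      using that by auto
    then have "(\<Prod>j\<in>{s<..Suc n}. 1 - q ^ j) = (1 - q ^ Suc n) * D s"
      by (simp add: D_def)
    then show ?thesis
      by (simp add: t'_def t_def power_add mult_ac)
  qed
  \<comment> \<open>The right-hand side is the partial sum of differences up to \<open>m\<close>; as
    a multiple of \<open>t (Suc m)\<close> it merges with the next difference.\<close>
  have step: "t (Suc m) * (1 - q ^ Suc m) = - t m * q ^ (n + 1 + m)" if "m < n" for m
  proof -
    have "{m<..n} = insert (Suc m) {Suc m<..n}"
      using that by auto
    then have "D m = (1 - q ^ Suc m) * D (Suc m)"
      by (simp add: D_def)
    then show ?thesis
      by (simp add: t_def power_add mult_ac)
  qed
  have telescope: "(\<Sum>s\<le>m. t' s - t s) = - t m * q ^ (n + 1 + m)" if "m \<le> n" for m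
    using that
  proof (induction m)
    case 0
    then show ?case by (simp add: t'_eq algebra_simps)
  next
    case (Suc m)
    have "(\<Sum>s\<le>Suc m. t' s - t s) = t (Suc m) * (1 - q ^ Suc m) + (t' (Suc m) - t (Suc m))"
      using Suc step[of m] by simp
    also have "\<dots> = - t (Suc m) * q ^ (n + 1 + Suc m)"
      using Suc.prems by (simp add: t'_eq algebra_simps power_add)
    finally show ?case .
  qed
  have "shanks_sum q (Suc n) - shanks_sum q n = t' (Suc n) + (\<Sum>s\<le>n. t' s - t s)"
    by (simp add: shanks_sum_def t_def t'_def D_def sum_subtractf)
  also have "\<dots> = t' (Suc n) - t n * q ^ (n + 1 + n)"
    using telescope[of n] by simp
  also have "\<dots> = (-1) ^ Suc n *
      (q ^ (Suc n * Suc n + triangle n) + q ^ (Suc n * Suc n + triangle (Suc n)))"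
    by (simp add: t'_def t_def D_def power_add algebra_simps)
  finally show ?thesis
    by (simp add: algebra_simps)
qed

text \<open>This form matches the exponents in \<open>shanks_sum_Suc\<close> and shows
  nonnegativity, so \<open>nat (p1 s)\<close> loses nothing. At \<open>n = 0\<close> the truncated
  \<open>n - 1\<close> is harmless, both sides being 0.\<close>

lemma p1_eq: "p1 n = int (n * n + triangle (n - 1))"
proof (cases n)
  case (Suc m)
  have "even (m * Suc m)"
    by simp
  then have "2 * int (triangle m) = int m * (int m + 1)"
    unfolding triangle_def
    by (metis dvd_mult_div_cancel of_nat_Suc of_nat_mult of_nat_numeral add.commute)
  then have "int n * (3 * int n - 1) = 2 * int (n * n + triangle (n - 1))"
    by (simp add: Suc algebra_simps)
  then show ?thesis
    by (simp add: p1_def)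
qed (simp add: p1_def)

lemma p2_eq: "p2 n = int (n * n + triangle n)"
proof -
  have "even (n * Suc n)"
    by simp
  then have "2 * int (triangle n) = int n * (int n + 1)"
    unfolding triangle_def
    by (metis dvd_mult_div_cancel of_nat_Suc of_nat_mult of_nat_numeral add.commute)
  then have "int n * (3 * int n + 1) = 2 * int (n * n + triangle n)"
    by (simp add: algebra_simps)
  then show ?thesis
    by (simp add: p2_def)
qed

lemma shanks_sum_pentagonal:
  fixes q :: "'a::comm_ring_1"
  shows "shanks_sum q n = 1 + (\<Sum>s=1..n. (-1) ^ s * (q ^ nat (p1 s) + q ^ nat (p2 s)))"
proof (induction n)
  case 0
  then show ?case by (simp add: shanks_sum_def)
next
  case (Suc n)
  then show ?case
    unfolding shanks_sum_Suc
    by (simp add: p1_eq p2_eq del: of_nat_add of_nat_mult of_nat_Suc power_Suc triangle_Suc mult_Suc)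
qed

text \<open>The summand \<open>s = 0\<close> is the whole product, and for \<open>s\<close> at least
  1 the exponent \<open>s * n + triangle s\<close> is at least \<open>n + 1\<close>.\<close>

lemma shanks_sum_eq_prod_modulo:
  fixes q :: "'a::comm_ring_1"
  shows "q ^ Suc n dvd shanks_sum q n - (\<Prod>j=1..n. 1 - q ^ j)"
proof -
  have "{0<..n} = {1..n}"
    by auto
  then have "shanks_sum q n - (\<Prod>j=1..n. 1 - q ^ j) =
      (\<Sum>s=1..n. (-1) ^ s * q ^ (s * n + triangle s) * (\<Prod>j\<in>{s<..n}. 1 - q ^ j))"
    by (simp add: shanks_sum_def atMost_atLeast0 sum.atLeast_Suc_atMost)
  moreover have "q ^ Suc n dvd (-1) ^ s * q ^ (s * n + triangle s) * (\<Prod>j\<in>{s<..n}. 1 - q ^ j)"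
    if s: "s \<in> {1..n}" for s
  proof -
    obtain r where "s = Suc r"
      using s not0_implies_Suc[of s] by auto
    then have "Suc n \<le> s * n + triangle s"
      by simp
    then show ?thesis
      by (intro dvd_mult2 dvd_mult le_imp_power_dvd)
  qed
  ultimately show ?thesis
    by (auto intro!: dvd_sum simp del: power_Suc)
qed

section \<open>Coefficients of the product as sums over pentagonal numbers\<close>

definition half_floor_fps :: "int fps" where
  "half_floor_fps = Abs_fps (\<lambda>m. int (m div 2) + 1)"

text \<open>The factor \<open>1 - fps_X ^ 2\<close> already leaves the geometric series, because
  \<open>m div 2\<close> grows by 1 when \<open>m\<close> grows by 2.\<close>

lemma half_floor_fps_inverse: "(1 - fps_X) * (1 - fps_X ^ 2) * half_floor_fps = 1"
proof -
  have "(1 - fps_X ^ 2) * half_floor_fps = Abs_fps (\<lambda>_. 1)"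
  proof (rule fps_ext)
    fix m
    show "fps_nth ((1 - fps_X ^ 2) * half_floor_fps) m = fps_nth (Abs_fps (\<lambda>_. 1)) m"
      by (auto simp: half_floor_fps_def left_diff_distrib fps_X_power_mult_nth; presburger)
  qed
  moreover have "(1 - fps_X) * Abs_fps (\<lambda>_. 1) = (1 :: int fps)"
    by (rule fps_ext) (auto simp: left_diff_distrib)
  ultimately show ?thesis
    by (simp add: mult.assoc)
qed

text \<open>The cut-off at 0 could be placed at \<open>-2\<close> as well, since \<open>x div 2 + 1 = 0\<close> for
  \<open>x \<in> {-2, -1}\<close>; this is where the offsets by 2 in the ranges of the theorem come from.\<close>

definition half_floor :: "int \<Rightarrow> int" where
  "half_floor x = (if x < 0 then 0 else x div 2 + 1)"

definition pentagonal_sum :: "nat \<Rightarrow> int \<Rightarrow> int" where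
  "pentagonal_sum N i = half_floor i +
    (\<Sum>s=1..N. (-1) ^ s * (half_floor (i - p1 s) + half_floor (i - p2 s)))"

lemma fps_nth_X_power_half_floor_fps:
  "fps_nth (fps_X ^ k * half_floor_fps) i = half_floor (int i - int k)"
  by (auto simp: half_floor_fps_def half_floor_def fps_X_power_mult_nth of_nat_diff zdiv_int)

lemma fps_nth_shanks_sum_half_floor_fps:
  "fps_nth (shanks_sum fps_X N * half_floor_fps) i = pentagonal_sum N (int i)"
proof -
  have neg: "fps_nth ((-1) ^ s * f) i = (-1) ^ s * fps_nth f i" for s and f :: "int fps"
    by (cases "even s") auto
  \<comment> \<open>The factor \<open>fps_X ^ 0\<close> lets the coefficient rule for shifted series
    cover the leading term too, hence \<open>del: power_0\<close> below.\<close>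
  have "shanks_sum fps_X N * half_floor_fps = fps_X ^ 0 * half_floor_fps +
    (\<Sum>s=1..N. (-1) ^ s * (fps_X ^ nat (p1 s) * half_floor_fps + fps_X ^ nat (p2 s) * half_floor_fps))"
    by (simp add: shanks_sum_pentagonal distrib_right sum_distrib_right mult.assoc)
  then show ?thesis
    by (simp add: fps_sum_nth neg fps_nth_X_power_half_floor_fps pentagonal_sum_def p1_eq p2_eq
        del: power_0 of_nat_add)
qed

text \<open>The partial product up to \<open>M\<close> has last factor
  \<open>1 - fps_X ^ (M + 3)\<close>, so restoring the two missing factors gives the finite Euler
  product of length \<open>M + 3\<close>. Replacing it by \<open>shanks_sum\<close> costs a multiple
  of \<open>fps_X ^ (M + 4)\<close>, invisible at index \<open>i\<close> once \<open>i\<close> is at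
  most \<open>M\<close>.\<close>

lemma coeff_eq_pentagonal_sum:
  fixes b :: "nat \<Rightarrow> int"
  assumes "qpochhammer_inf (fps_X ^ 3) fps_X = Abs_fps b"
  shows "\<forall>\<^sub>F M in sequentially. b i = pentagonal_sum (M + 3) (int i)"
proof -
  define P where "P = (\<lambda>M. \<Prod>k\<le>M. 1 - fps_X ^ 3 * fps_X ^ k :: int fps)"
  have "P \<longlonglongrightarrow> Abs_fps b"
    unfolding P_def
    using has_prod_imp_tendsto[OF has_prod_qpochhammer_inf_X3] assms by simp
  then have "\<forall>\<^sub>F M in sequentially. fps_nth (P M) i = b i"
    by (simp add: tendsto_fps_iff)
  then show ?thesis
    using eventually_ge_at_top[of i]
  proof eventually_elim
    case (elim M)
    have prod: "(\<Prod>j=1..M+3. 1 - fps_X ^ j :: int fps) = (1 - fps_X) * (1 - fps_X ^ 2) * P M"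
    proof (induction M)
      case 0
      then show ?case
        by (simp add: P_def numeral_3_eq_3 numeral_2_eq_2)
    next
      case (Suc M)
      then show ?case
        by (simp add: P_def power_add mult_ac numeral_3_eq_3)
    qed
    obtain R where "shanks_sum fps_X (M + 3) - (1 - fps_X) * (1 - fps_X ^ 2) * P M =
        fps_X ^ Suc (M + 3) * R"
      using shanks_sum_eq_prod_modulo[of "fps_X :: int fps" "M + 3"] prod by (auto elim: dvdE)
    then have "shanks_sum fps_X (M + 3) =
        (1 - fps_X) * (1 - fps_X ^ 2) * P M + fps_X ^ Suc (M + 3) * R"
      by (metis diff_eq_eq add.commute)
    then have "shanks_sum fps_X (M + 3) * half_floor_fps =
        ((1 - fps_X) * (1 - fps_X ^ 2) * half_floor_fps) * P M +
        fps_X ^ Suc (M + 3) * (R * half_floor_fps)"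
      by (simp only: distrib_left distrib_right mult_ac)
    also have "\<dots> = P M + fps_X ^ Suc (M + 3) * (R * half_floor_fps)"
      by (simp only: half_floor_fps_inverse mult_1)
    finally have "fps_nth (shanks_sum fps_X (M + 3) * half_floor_fps) i = fps_nth (P M) i"
      using elim by (simp add: fps_X_power_mult_nth del: power_Suc)
    with elim show ?case
      by (simp add: fps_nth_shanks_sum_half_floor_fps)
  qed
qed

section \<open>Evaluation of the pentagonal sum\<close>

lemma pentagonal_shift:
  shows "p1 (2 * n) = p2 (2 * n) - 2 * int n"
    and "p1 (2 * n + 1) = p2 (2 * n) + 4 * int n + 1"
    and "p2 (2 * n + 1) = p2 (2 * n) + 6 * int n + 2"
    and "p1 (2 * n + 2) = p2 (2 * n) + 10 * int n + 5"
    and "p2 (2 * n + 2) = p2 (2 * n) + 12 * int n + 7"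
proof -
  show "p1 (2 * n) = p2 (2 * n) - 2 * int n"
    by (cases n) (simp_all add: p1_eq p2_eq)
qed (simp_all add: p1_eq p2_eq algebra_simps)

lemma diff_double_div_2: "(y - 2 * k) div 2 = y div 2 - k" for y k :: int
  by presburger

lemma half_floor_eq: "-2 \<le> x \<Longrightarrow> half_floor x = x div 2 + 1"
  unfolding half_floor_def by presburger

text \<open>Induction in steps of four pentagonal numbers: the first three new terms reduce the
  previous value to the constant \<open>- int (Suc n)\<close>, and the fourth yields the case
  distinction.\<close>

lemma pentagonal_sum_even:
  assumes "p1 (2 * n) - 2 \<le> i" "0 \<le> i"
  shows "pentagonal_sum (2 * n) i =
    (if i < p2 (2 * n) then - int n else (i - p2 (2 * n)) div 2 + 1 - int n)"
  using assms
proof (induction n)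
  case 0
  then show ?case
    by (simp add: pentagonal_sum_def half_floor_def p2_def)
next
  case (Suc n)
  note shift = pentagonal_shift[of n, simplified]
  define x where "x = i - p2 (2 * n)"
  \<comment> \<open>This excludes the first branch of the induction hypothesis and keeps the first
    three new arguments at least -2, where \<open>half_floor_eq\<close> applies. The fourth may be
    smaller and stays unevaluated.\<close>
  have x: "10 * int n + 3 \<le> x"
    using Suc.prems(1) shift by (simp add: x_def)
  have "pentagonal_sum (2 * Suc n) i = pentagonal_sum (2 * n) i
      - (half_floor (i - p1 (2 * n + 1)) + half_floor (i - p2 (2 * n + 1)))
      + (half_floor (i - p1 (2 * n + 2)) + half_floor (i - p2 (2 * n + 2)))"
    by (simp add: pentagonal_sum_def)
  moreover have "pentagonal_sum (2 * n) i = (i - p2 (2 * n)) div 2 + 1 - int n"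
    using Suc shift by simp
  \<comment> \<open>Odd offsets are expressed by \<open>(x - 1) div 2\<close>, even ones by
    \<open>x div 2\<close>; each quotient then occurs with both signs and cancels.\<close>
  moreover have "half_floor (x - 4 * int n - 1) = (x - 1) div 2 - 2 * int n + 1"
    using x diff_double_div_2[of "x - 1" "2 * int n"] by (simp add: half_floor_eq algebra_simps)
  moreover have "half_floor (x - 6 * int n - 2) = x div 2 - 3 * int n"
    using x diff_double_div_2[of x "3 * int n + 1"] by (simp add: half_floor_eq algebra_simps)
  moreover have "half_floor (x - 10 * int n - 5) = (x - 1) div 2 - 5 * int n - 1"
    using x diff_double_div_2[of "x - 1" "5 * int n + 2"] by (simp add: half_floor_eq algebra_simps)
  moreover have "i - p1 (2 * n + 1) = x - 4 * int n - 1" "i - p2 (2 * n + 1) = x - 6 * int n - 2"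
    "i - p1 (2 * n + 2) = x - 10 * int n - 5" "i - p2 (2 * n) = x" "2 * n + 2 = 2 * Suc n"
    using shift by (simp_all add: x_def)
  ultimately have "pentagonal_sum (2 * Suc n) i =
      (x div 2 + 1 - int n)
      - ((x - 1) div 2 - 2 * int n + 1 + (x div 2 - 3 * int n))
      + ((x - 1) div 2 - 5 * int n - 1 + half_floor (i - p2 (2 * Suc n)))"
    by (simp only:)
  then have "pentagonal_sum (2 * Suc n) i = half_floor (i - p2 (2 * Suc n)) - int (Suc n)"
    by simp
  then show ?case
    by (simp add: half_floor_def)
qed

text \<open>Beyond \<open>pentagonal_sum_even\<close> only the two terms of index
  \<open>2 * n + 1\<close> can contribute, since all later pentagonal numbers exceed
  \<open>i\<close>.\<close>

lemma pentagonal_sum_block: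
  assumes "p1 (2 * n) - 2 \<le> i" "i \<le> p1 (2 * n + 2) - 3" "0 \<le> i" "2 * n + 1 \<le> N"
  shows "pentagonal_sum N i =
    (if i < p2 (2 * n) then - int n else (i - p2 (2 * n)) div 2 + 1 - int n)
    - half_floor (i - p1 (2 * n + 1)) - half_floor (i - p2 (2 * n + 1))"
  using assms(4)
proof (induction N rule: dec_induct)
  case base
  have "pentagonal_sum (2 * n + 1) i = pentagonal_sum (2 * n) i
      - half_floor (i - p1 (2 * n + 1)) - half_floor (i - p2 (2 * n + 1))"
    by (simp add: pentagonal_sum_def)
  with assms show ?case
    by (simp only: pentagonal_sum_even)
next
  case (step N)
  have mono: "p1 a \<le> p1 b" if "a \<le> b" for a b
    unfolding p1_eq triangle_def of_nat_le_iff
    using that by (intro add_mono mult_mono div_le_mono) auto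
  have "p1 k \<le> p2 k" for k
    unfolding p1_eq p2_eq triangle_def of_nat_le_iff
    by (intro add_mono mult_mono div_le_mono) auto
  moreover have "i < p1 (Suc N)"
    using mono[of "2 * n + 2" "Suc N"] step(1) assms(2) by simp
  ultimately have "i < p1 (Suc N)" "i < p2 (Suc N)"
    by (auto intro: less_le_trans)
  then have "pentagonal_sum (Suc N) i = pentagonal_sum N i"
    by (simp add: pentagonal_sum_def half_floor_def)
  with step show ?case
    by simp
qed

section \<open>The blocks partition the indices\<close>

text \<open>Each block ends one below the start of the next, and the first starts at -2. The block
  of \<open>i\<close> is the first whose upper end reaches \<open>i\<close>.\<close>

lemma block_exists_unique: "\<exists>!n. p1 (2 * n) - 2 \<le> int i \<and> int i \<le> p1 (2 * n + 2) - 3"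
proof -
  have mono: "strict_mono (\<lambda>n. p1 (2 * n))"
    by (rule strict_monoI_Suc) (use pentagonal_shift(1,4) in simp)
  have "int n \<le> p1 (2 * n)" for n
    unfolding p1_eq of_nat_le_iff by (cases n) auto
  then have ex: "int i \<le> p1 (2 * (i + 3)) - 3"
    by (metis add.commute le_diff_eq of_nat_add of_nat_numeral)
  define n where "n = (LEAST n. int i \<le> p1 (2 * n + 2) - 3)"
  have upper: "int i \<le> p1 (2 * n + 2) - 3"
    \<comment> \<open>The witness \<open>i + 2\<close> fits because
      \<open>2 * (i + 2) + 2 = 2 * (i + 3)\<close>.\<close>
    unfolding n_def by (rule LeastI[of _ "i + 2"]) (use ex in \<open>simp add: numeral_eq_Suc\<close>)
  have lower: "p1 (2 * n) - 2 \<le> int i"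
  proof (cases n)
    case (Suc m)
    then have "\<not> int i \<le> p1 (2 * m + 2) - 3"
      using not_less_Least[of m "\<lambda>n. int i \<le> p1 (2 * n + 2) - 3"] unfolding n_def by simp
    with Suc show ?thesis by simp
  qed (simp add: p1_def)
  have "m = n" if m: "p1 (2 * m) - 2 \<le> int i" "int i \<le> p1 (2 * m + 2) - 3" for m
  proof (rule ccontr)
    assume "m \<noteq> n"
    then consider "Suc m \<le> n" | "Suc n \<le> m"
      by linarith
    then show False
      by cases (use strict_mono_leD[OF mono] m upper lower in fastforce)+
  qed
  with upper lower show ?thesis
    by blast
qed

section \<open>Reading off the five ranges\<close>

theorem theorem2p3:
  fixes b :: "nat \<Rightarrow> int" and i :: nat
  assumes "qpochhammer_inf (fps_X ^ 3) fps_X = Abs_fps b"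
  shows "(\<exists>!n::nat. p1 (2 * n) - 2 \<le> int i \<and> int i \<le> p1 (2 * n + 2) - 3) \<and>
    (\<forall>n::nat. p1 (2 * n) - 2 \<le> int i \<and> int i \<le> p1 (2 * n + 2) - 3 \<longrightarrow>
      (p1 (2 * n) - 2 \<le> int i \<and> int i \<le> p2 (2 * n) - 1 \<longrightarrow>
        b i = - int n) \<and>
      (p2 (2 * n) \<le> int i \<and> int i \<le> p1 (2 * n + 1) - 2 \<longrightarrow>
        b i = 1 - int n + \<lfloor>real_of_int (int i - p2 (2 * n)) / 2\<rfloor>) \<and>
      (p1 (2 * n + 1) - 1 \<le> int i \<and> int i \<le> p2 (2 * n + 1) - 2 \<and> [int i = p2 (2 * n)] (mod 2) \<longrightarrow>
        b i = 1 + int n) \<and>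
      (p1 (2 * n + 1) - 1 \<le> int i \<and> int i \<le> p2 (2 * n + 1) - 2 \<and> \<not> [int i = p2 (2 * n)] (mod 2) \<longrightarrow>
        b i = int n) \<and>
      (p2 (2 * n + 1) - 1 \<le> int i \<and> int i \<le> p1 (2 * n + 2) - 3 \<longrightarrow>
        b i = int n - \<lceil>real_of_int (int i - p2 (2 * n + 1)) / 2\<rceil>))"
proof (intro conjI allI impI)
  show "\<exists>!n. p1 (2 * n) - 2 \<le> int i \<and> int i \<le> p1 (2 * n + 2) - 3"
    by (rule block_exists_unique)
next
  fix n
  assume block: "p1 (2 * n) - 2 \<le> int i \<and> int i \<le> p1 (2 * n + 2) - 3"
  \<comment> \<open>In terms of \<open>x\<close> the ranges become \<open>x < 0\<close>, then 0 to
    4n-1, 4n to 6n (split by parity), and 6n+1 to 10n+2.\<close>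
  define x where "x = int i - p2 (2 * n)"
  note shift = pentagonal_shift[of n]
  have "\<forall>\<^sub>F M in sequentially. b i = pentagonal_sum (M + 3) (int i) \<and> 2 * n + 1 \<le> M"
    using coeff_eq_pentagonal_sum[OF assms] eventually_ge_at_top by (rule eventually_conj)
  from eventually_happens'[OF sequentially_bot this]
  obtain M where "b i = pentagonal_sum (M + 3) (int i)" "2 * n + 1 \<le> M"
    by blast
  with pentagonal_sum_block[of n "int i" "M + 3"] block
  have "b i = (if int i < p2 (2 * n) then - int n else (int i - p2 (2 * n)) div 2 + 1 - int n)
    - half_floor (int i - p1 (2 * n + 1)) - half_floor (int i - p2 (2 * n + 1))"
    by simp
  moreover have "int i - p1 (2 * n + 1) = x - 4 * int n - 1" "int i - p2 (2 * n + 1) = x - 6 * int n - 2"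
    "int i < p2 (2 * n) \<longleftrightarrow> x < 0"
    using shift by (simp_all add: x_def)
  ultimately have b: "b i = (if x < 0 then - int n else x div 2 + 1 - int n)
    - half_floor (x - 4 * int n - 1) - half_floor (x - 6 * int n - 2)"
    by (simp only: x_def)
  have floor: "\<lfloor>real_of_int y / 2\<rfloor> = y div 2" for y
    by (metis floor_divide_of_int_eq of_int_numeral)
  have ceil: "\<lceil>real_of_int y / 2\<rceil> = - (- y div 2)" for y
    by (metis ceiling_divide_eq_div of_int_numeral)
  \<comment> \<open>The difference of quotients is 1 for even \<open>x\<close> and 0 for odd
    \<open>x\<close>. At \<open>x = 4 * int n\<close> the argument of \<open>half_floor\<close> is
    -1, still covered by \<open>half_floor_eq\<close>.\<close>
  have middle: "b i = x div 2 - (x - 1) div 2 + int n" if "4 * int n \<le> x" "x \<le> 6 * int n"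
  proof -
    have "half_floor (x - 4 * int n - 1) = (x - 1) div 2 - 2 * int n + 1"
      using that diff_double_div_2[of "x - 1" "2 * int n"] by (simp add: half_floor_eq algebra_simps)
    moreover have "half_floor (x - 6 * int n - 2) = 0" "\<not> x < 0"
      using that by (simp_all add: half_floor_def)
    ultimately show ?thesis
      by (simp add: b)
  qed
  {
    assume "p1 (2 * n) - 2 \<le> int i \<and> int i \<le> p2 (2 * n) - 1"
    then have "x < 0"
      by (simp add: x_def)
    then show "b i = - int n"
      by (simp add: b half_floor_def)
  next
    assume "p2 (2 * n) \<le> int i \<and> int i \<le> p1 (2 * n + 1) - 2"
    then have "0 \<le> x" "x < 4 * int n + 1"
      using shift by (simp_all add: x_def)
    then show "b i = 1 - int n + \<lfloor>real_of_int (int i - p2 (2 * n)) / 2\<rfloor>"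
      unfolding floor by (simp add: b half_floor_def x_def[symmetric])
  next
    assume *: "p1 (2 * n + 1) - 1 \<le> int i \<and> int i \<le> p2 (2 * n + 1) - 2 \<and> [int i = p2 (2 * n)] (mod 2)"
    then have "even x"
      by (simp add: x_def cong_iff_dvd_diff)
    moreover have bounds: "4 * int n \<le> x" "x \<le> 6 * int n"
      using * shift by (simp_all add: x_def)
    ultimately show "b i = 1 + int n"
      unfolding middle[OF bounds] by presburger
  next
    assume *: "p1 (2 * n + 1) - 1 \<le> int i \<and> int i \<le> p2 (2 * n + 1) - 2 \<and> \<not> [int i = p2 (2 * n)] (mod 2)"
    then have "odd x"
      by (simp add: x_def cong_iff_dvd_diff)
    moreover have bounds: "4 * int n \<le> x" "x \<le> 6 * int n"
      using * shift by (simp_all add: x_def)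
    ultimately show "b i = int n"
      unfolding middle[OF bounds] by presburger
  next
    assume *: "p2 (2 * n + 1) - 1 \<le> int i \<and> int i \<le> p1 (2 * n + 2) - 3"
    then have "6 * int n + 1 \<le> x"
      using shift by (simp add: x_def)
    moreover have "int i - p2 (2 * n + 1) = x - 6 * int n - 2"
      using shift by (simp add: x_def)
    \<comment> \<open>Measured from \<open>p2 (2 * n + 1)\<close>, the \<open>y div 2\<close> terms
      cancel and \<open>(y + 1) div 2\<close>, the ceiling of y/2, remains. The range begins at
      \<open>y = -1\<close>, again within \<open>half_floor_eq\<close>.\<close>
    moreover define y where "y = x - 6 * int n - 2"
    ultimately have y: "int i - p2 (2 * n + 1) = y" "x = y + 6 * int n + 2" "-1 \<le> y"
      by simp_all
    have "half_floor (x - 4 * int n - 1) = (y + 1) div 2 + int n + 1"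
      using y diff_double_div_2[of "y + 1" "- int n"] by (simp add: half_floor_eq algebra_simps)
    moreover have "half_floor (x - 6 * int n - 2) = y div 2 + 1"
      using y by (simp add: half_floor_eq)
    moreover have "x div 2 = y div 2 + 3 * int n + 1"
      using y diff_double_div_2[of y "- 3 * int n - 1"] by (simp add: algebra_simps)
    moreover have "- (- y div 2) = (y + 1) div 2"
      by presburger
    moreover have "\<not> x < 0"
      using y by simp
    ultimately show "b i = int n - \<lceil>real_of_int (int i - p2 (2 * n + 1)) / 2\<rceil>"
      unfolding ceil b y(1) by simp
  }
qed

end
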